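(* Let $Y$ be a vertex algebra structure on the chiral boson. Given finite sets $S_1,S_2\subset\mathbb P\setminus P$, states $\mathtt v_1\in{}_{S_1}\mathbf W$, $\mathtt v_2\in{}_{S_2}\mathbf W$ and translations $v_1,v_2$ with $(S_1+v_1)\cap(S_2+v_2)=\emptyset$, one has $$Y(\mathtt v_1,v_1)\circ Y(\mathtt v_2,v_2)=Y\bigl(Y(\mathtt v_1,v_1-v_2)\mathtt v_2,\ v_2\bigr)$$ on $\mathbf W^{(S_1+v_1)\cup(S_2+v_2)}$.
   Context: Fix a point $P$ of a complex projective line $\mathbb P$. Translations are the automorphisms in the additive group ($\cong\mathbb C$) of translations of the affine line $\mathbb P\setminus P$; $z+v$ is the action of $v$ on $z$; in a coordinate $u$ with pole at $P$, $u(z+v)=u(z)+u(v)$. $\mathbf K$ is the space of meromorphic 1-forms on $\mathbb P$ with all residues zero, regular at $P$; $\mathbf W=S^*\mathbf K$, vacuum $\mathbf 1$. For a finite set $S\subset\mathbb P\setminus P$: ${}_S\mathbf W=S^*({}_S\mathbf K)$ with ${}_S\mathbf K\subset\mathbf K$ the forms with all poles in $S$; $\mathbf W^S=S^*(\mathbf K^S)$ with $\mathbf K^S\subset\mathbf K$ the forms regular at every point of $S$. $\mathsf T_v:\mathbf W\to\mathbf W$ is induced by $a(u)du\mapsto a(u-u(v))du$ and maps ${}_S\mathbf W$ to ${}_{S+v}\mathbf W$. For $O\ne P$ and $\lambda\in\mathbb C^*=\mathrm{Aut}_{O,P}(\mathbb P)$ acting by $u(\lambda(z))=\lambda u(z)$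 (with $u(O)=0$, $u(P)=\infty$), $\mathsf R_\lambda$ is the operator on $\mathbf W$ induced by pull-back by $\lambda^{-1}$. A vertex algebra structure on the chiral boson is an assignment, linear in the state, to each finite set $S$, state $\mathtt v\in{}_S\mathbf W$ and translation $v$ of an operator $Y(\mathtt v,v):\mathbf W^{S+v}\to\mathbf W$ (compatible with enlarging $S$), such that: 1. if $\mathtt v'\in{}_{S'}\mathbf W\cap\mathbf W^{S+v}$ then $Y(\mathtt v,v)\mathtt v'\in{}_{S'\cup(S+v)}\mathbf W$; 2. $Y(\mathbf 1,v)=\mathrm{Id}$; 3. $Y(\mathtt v,0)\mathbf 1=\mathtt v$; 4. for $\mathtt v\in{}_S\mathbf W$, $\mathtt v'\in{}_{S'}\mathbf W$, the operators $Y(\mathtt v,v)$ and $Y(\mathtt v',v')$ commute if $S+v$ is disjoint from $S'+v'$ (where both compositions are defined); 5. $Y(\mathtt v,v+v')=\mathsf T_{v'}\circ Y(\mathtt v,v)\circ\mathsf T_{-v'}$ for translations $v,v'$; 6. $Y$ is $\mathrm{Aut}_P(\mathbb P)$-covariant: $Y(\mathsf T_{v'}\mathtt v,v)=\mathsf T_{v'}Y(\mathtt v,v)\mathsf T_{-v'}$ and $Y(\mathsf R_\lambda\mathtt v,\lambda v)=\mathsf R_\lambda Y(\mathtt v,v)\mathsf R_{\lambda^{-1}}$ for rotations $\lambda$ about any point $O$; 7. for a fixed point $O$, the vectors $Y(\mathtt v_n,v_n)\cdots Y(\mathtt v_1,v_1)\mathbf 1$, over all sequences of distinct translations $v_i$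 and states $\mathtt v_i\in{}_{\{O\}}\mathbf W$, span $\mathbf W$. *)

theory Defs
  imports
    "HOL-Complex_Analysis.Complex_Analysis"
    "HOL-Library.Poly_Mapping"
    "HOL-Library.Multiset"
begin

text \<open>
  Fix a coordinate \<open>u\<close> on the projective line with its pole at the marked point \<open>P\<close>. A
  meromorphic 1-form is written \<open>a(u) du\<close>, with \<open>a\<close> meromorphic on the plane; to make \<open>a\<close> unique it is
  taken in the normal form \<^const>\<open>nicely_meromorphic_on\<close> (value \<open>0\<close> at poles, no removable
  singularities). With \<open>w = 1 / u\<close> at \<open>P\<close> one has \<open>a(u) du = - a(1 / w) / w\<^sup>2 dw\<close>, so the form is regular
  at \<open>P\<close> iff this coefficient has a finite limit at \<open>w = 0\<close>. Its residue at \<open>P\<close> then vanishes too.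
\<close>

definition is_K_coeff :: "(complex \<Rightarrow> complex) \<Rightarrow> bool" where
  "is_K_coeff a \<longleftrightarrow>
     a nicely_meromorphic_on UNIV \<and>
     (\<forall>z. residue a z = 0) \<and>
     (\<exists>l. (\<lambda>w. - a (1 / w) / w\<^sup>2) \<midarrow>0\<rightarrow> l)"

lemma nicely_remove_sings:
  assumes "a nicely_meromorphic_on UNIV"
  shows "remove_sings a z = a z"
  using assms unfolding nicely_meromorphic_on_def
  by (metis UNIV_I remove_sings_at_pole remove_sings_eqI)

lemma nicely_isolated:
  assumes "a nicely_meromorphic_on UNIV"
  shows "isolated_singularity_at a z"
  using assms meromorphic_on_isolated_singularity meromorphic_on_subset
  unfolding nicely_meromorphic_on_def by blast

lemma nicely_add_eventually:
  assumes "a nicely_meromorphic_on UNIV" "b nicely_meromorphic_on UNIV"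
  shows "\<forall>\<^sub>F w in at z. remove_sings (\<lambda>z. a z + b z) w = a w + b w"
  by (intro eventually_remove_sings_eq_at isolated_singularity_at_add nicely_isolated assms)

lemma residue_add_isolated:
  assumes "isolated_singularity_at a z" "isolated_singularity_at b z"
  shows "residue (\<lambda>z. a z + b z) z = residue a z + residue b z"
proof -
  from assms obtain A B where "open A" "z \<in> A" "a holomorphic_on (A - {z})"
     "open B" "z \<in> B" "b holomorphic_on (B - {z})"
    using analytic_imp_holomorphic isolated_singularity_at_iff_analytic_nhd by meson
  then show ?thesis
    by (intro residue_add[of "A \<inter> B"]) (auto intro: holomorphic_on_subset)
qed

lemma is_K_coeff_analytic_infinity:
  assumes "is_K_coeff a"
  shows "\<forall>\<^sub>F z in at_infinity. a analytic_on {z}"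
proof -
  from assms obtain l where "(\<lambda>w. - a (1 / w) / w\<^sup>2) \<midarrow>0\<rightarrow> l"
    unfolding is_K_coeff_def by blast
  then have "\<forall>\<^sub>F w in at 0. norm (- a (1 / w) / w\<^sup>2) < norm l + 1"
    by (intro order_tendstoD(2)[OF tendsto_norm]) auto
  then obtain r where r: "r > 0"
     "\<And>w. w \<noteq> 0 \<Longrightarrow> norm w < r \<Longrightarrow> norm (- a (1 / w) / w\<^sup>2) < norm l + 1"
    unfolding eventually_at by (auto simp: dist_norm)
  have bound: "norm (a z) \<le> (norm l + 1) * r\<^sup>2" if "norm z > 1 / r" for z
  proof -
    have z: "z \<noteq> 0" using that r(1) by (auto simp: divide_less_0_iff)
    have "norm (1 / z) < r"
      using that r(1) z by (simp add: norm_divide field_simps)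
    with r(2)[of "1 / z"] z have "norm (a z) * (norm z)\<^sup>2 < norm l + 1"
      by (simp add: norm_divide norm_mult norm_power power_divide field_simps)
    then have "norm (a z) < (norm l + 1) * (norm (1 / z))\<^sup>2"
      using z by (simp add: norm_divide power_divide field_simps)
    also have "\<dots> \<le> (norm l + 1) * r\<^sup>2"
      using \<open>norm (1 / z) < r\<close> by (intro mult_left_mono power_mono) auto
    finally show ?thesis by simp
  qed
  have "a analytic_on {z}" if z: "norm z > 1 / r" for z
  proof (rule nicely_meromorphic_on_imp_analytic_at[of _ UNIV])
    show "a nicely_meromorphic_on UNIV"
      using assms by (simp add: is_K_coeff_def)
    show "\<not> is_pole a z"
    proof
      assume "is_pole a z"
      then have "\<forall>\<^sub>F x in at z. norm (a x) > (norm l + 1) * r\<^sup>2"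
        unfolding is_pole_def by (simp add: filterlim_at_infinity_conv_norm_at_top filterlim_at_top_dense)
      moreover have "\<forall>\<^sub>F x in at z. norm x > 1 / r"
        by (rule order_tendstoD(1)[OF tendsto_norm[OF tendsto_ident_at] z])
      ultimately have "\<forall>\<^sub>F x in at z. False"
        by eventually_elim (use bound in force)
      then show False by simp
    qed
  qed simp
  then show ?thesis
    unfolding eventually_at_infinity by (intro exI[of _ "1 / r + 1"]) auto
qed

lemma is_K_coeff_zero: "is_K_coeff (\<lambda>_. 0)"
  unfolding is_K_coeff_def by (auto simp: residue_const)

lemma is_K_coeff_add:
  assumes a: "is_K_coeff a" and b: "is_K_coeff b"
  shows "is_K_coeff (remove_sings (\<lambda>z. a z + b z))"
proof -
  let ?s = "remove_sings (\<lambda>z. a z + b z)"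
  have na: "a nicely_meromorphic_on UNIV" and nb: "b nicely_meromorphic_on UNIV"
    using a b by (auto simp: is_K_coeff_def)
  have "?s nicely_meromorphic_on UNIV"
    using na nb by (intro remove_sings_nicely_meromorphic meromorphic_intros)
      (auto simp: nicely_meromorphic_on_def)
  moreover have "residue ?s z = 0" for z
  proof -
    have "residue ?s z = residue (\<lambda>z. a z + b z) z"
      by (intro residue_remove_sings isolated_singularity_at_add nicely_isolated na nb)
    also have "\<dots> = residue a z + residue b z"
      by (intro residue_add_isolated nicely_isolated na nb)
    finally show ?thesis using a b by (simp add: is_K_coeff_def)
  qed
  moreover have "\<exists>l. (\<lambda>w. - ?s (1 / w) / w\<^sup>2) \<midarrow>0\<rightarrow> l"
  proof -
    obtain l m where l: "(\<lambda>w. - a (1 / w) / w\<^sup>2) \<midarrow>0\<rightarrow> l" and m: "(\<lambda>w. - b (1 / w) / w\<^sup>2) \<midarrow>0\<rightarrow> m"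
      using a b unfolding is_K_coeff_def by blast
    have "\<forall>\<^sub>F z in at_infinity. ?s z = a z + b z"
      using is_K_coeff_analytic_infinity[OF a] is_K_coeff_analytic_infinity[OF b]
      by eventually_elim (auto intro!: remove_sings_at_analytic analytic_intros)
    then have "\<forall>\<^sub>F w in at 0. ?s (1 / w) = a (1 / w) + b (1 / w)"
      using filterlim_inverse_at_infinity[where 'a = complex]
      unfolding filterlim_iff inverse_eq_divide by blast
    then have "\<forall>\<^sub>F w in at 0. - a (1 / w) / w\<^sup>2 + - b (1 / w) / w\<^sup>2 = - ?s (1 / w) / w\<^sup>2"
      by eventually_elim (simp add: diff_divide_distrib)
    with tendsto_add[OF l m] have "(\<lambda>w. - ?s (1 / w) / w\<^sup>2) \<midarrow>0\<rightarrow> l + m"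
      by (rule Lim_transform_eventually)
    then show ?thesis by blast
  qed
  ultimately show ?thesis by (simp add: is_K_coeff_def)
qed

lemma residue_lmul_isolated:
  assumes "isolated_singularity_at a z"
  shows "residue (\<lambda>z. c * a z) z = c * residue a z"
proof -
  from assms obtain A where "open A" "z \<in> A" "a holomorphic_on (A - {z})"
    using analytic_imp_holomorphic isolated_singularity_at_iff_analytic_nhd by meson
  then show ?thesis
    by (intro residue_lmul[of A]) auto
qed

lemma is_K_coeff_scale:
  assumes a: "is_K_coeff a"
  shows "is_K_coeff (\<lambda>z. c * a z)"
proof -
  obtain l where l: "(\<lambda>w. - a (1 / w) / w\<^sup>2) \<midarrow>0\<rightarrow> l"
    using a unfolding is_K_coeff_def by blast
  have "(\<lambda>w. - (c * a (1 / w)) / w\<^sup>2) \<midarrow>0\<rightarrow> c * l"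
    using tendsto_mult_left[OF l, of c] by simp
  moreover have "residue (\<lambda>z. c * a z) z = 0" for z
    using a residue_lmul_isolated[OF nicely_isolated] by (simp add: is_K_coeff_def)
  ultimately show ?thesis
    using a by (auto simp: is_K_coeff_def intro!: nicely_meromorphic_on_cmult_left)
qed

lemma filtermap_affine_at:
  fixes c d z :: complex
  assumes "c \<noteq> 0"
  shows "filtermap (\<lambda>z. c * z + d) (at z) = at (c * z + d)"
proof (rule filtermap_fun_inverse)
  show "filterlim (\<lambda>w. (w - d) / c) (at z) (at (c * z + d))"
    using assms
    by (intro filterlim_atI) (auto simp: eventually_at_filter field_simps intro!: tendsto_eq_intros)
  show "filterlim (\<lambda>z. c * z + d) (at (c * z + d)) (at z)"
    using assms
    by (intro filterlim_atI) (auto simp: eventually_at_filter intro!: tendsto_eq_intros)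
qed (use assms in auto)

lemma residue_affine:
  fixes c d z :: complex
  assumes "c \<noteq> 0" "a nicely_meromorphic_on UNIV" "residue a (c * z + d) = 0"
  shows "residue (\<lambda>z. a (c * z + d)) z = 0"
proof -
  obtain F where F: "(\<lambda>w. a ((c * z + d) + w)) has_laurent_expansion F"
    using assms(2) unfolding nicely_meromorphic_on_def meromorphic_on_def by blast
  have G: "(\<lambda>w. c * w) has_laurent_expansion fps_to_fls (fps_const c * fps_X)"
    by (intro has_laurent_expansion_fps fps_expansion_intros)
  have "((\<lambda>w. a ((c * z + d) + w)) \<circ> (\<lambda>w. c * w)) has_laurent_expansion
          fls_compose_fps F (fps_const c * fps_X)"
    by (intro has_laurent_expansion_compose F G) (use assms(1) in auto)
  then have "(\<lambda>w. a (c * (z + w) + d)) has_laurent_expansion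
          fls_compose_fps F (fps_const c * fps_X)"
    by (simp add: o_def algebra_simps)
  then have "residue (\<lambda>z. a (c * z + d)) z = fls_residue (fls_compose_fps F (fps_const c * fps_X))"
    by (rule has_laurent_expansion_residue)
  also have "\<dots> = fls_residue F * c powi (-1)"
    using fls_nth_fls_compose_fps_linear[OF assms(1), of F "-1"] by simp
  also have "fls_residue F = 0"
    using has_laurent_expansion_residue[OF F] assms(3) by simp
  finally show ?thesis by simp
qed

lemma is_K_coeff_affine:
  fixes c d :: complex
  assumes a: "is_K_coeff a" and c: "c \<noteq> 0"
  shows "is_K_coeff (\<lambda>z. a (c * z + d))"
proof -
  have na: "a nicely_meromorphic_on UNIV" using a by (simp add: is_K_coeff_def)
  have "(\<lambda>z. a (c * z + d)) nicely_meromorphic_on UNIV"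
    unfolding nicely_meromorphic_on_def
  proof (intro conjI ballI)
    show "(\<lambda>z. a (c * z + d)) meromorphic_on UNIV"
      by (rule meromorphic_on_compose[of _ UNIV])
         (use na in \<open>auto simp: nicely_meromorphic_on_def intro!: analytic_intros\<close>)
    fix z
    have "is_pole (a \<circ> (\<lambda>z. c * z + d)) z \<longleftrightarrow> is_pole a (c * z + d)"
      by (intro is_pole_compose_iff filtermap_affine_at c)
    moreover have "((a \<circ> (\<lambda>z. c * z + d)) \<midarrow>z\<rightarrow> a (c * z + d)) \<longleftrightarrow> (a \<midarrow>c * z + d\<rightarrow> a (c * z + d))"
      unfolding filterlim_def filtermap_compose filtermap_affine_at[OF c] ..
    ultimately show "is_pole (\<lambda>z. a (c * z + d)) z \<and> a (c * z + d) = 0 \<or>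
        (\<lambda>z. a (c * z + d)) \<midarrow>z\<rightarrow> a (c * z + d)"
      using na by (simp add: nicely_meromorphic_on_def o_def)
  qed
  moreover have "residue (\<lambda>z. a (c * z + d)) z = 0" for z
    using a by (intro residue_affine c) (auto simp: is_K_coeff_def)
  moreover have "\<exists>l. (\<lambda>w. - a (c * (1 / w) + d) / w\<^sup>2) \<midarrow>0\<rightarrow> l"
  proof -
    obtain l where l: "(\<lambda>w. - a (1 / w) / w\<^sup>2) \<midarrow>0\<rightarrow> l"
      using a unfolding is_K_coeff_def by blast
    let ?g = "\<lambda>w. w / (c + d * w)"
    have lim: "?g \<midarrow>0\<rightarrow> 0" using c by (auto intro!: tendsto_eq_intros)
    have "(\<lambda>w. c + d * w) \<midarrow>0\<rightarrow> c" by (auto intro!: tendsto_eq_intros)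
    then have nz: "\<forall>\<^sub>F w in at 0. c + d * w \<noteq> 0"
      using c by (rule tendsto_imp_eventually_ne)
    have nz': "\<forall>\<^sub>F w in at (0::complex). w \<noteq> 0"
      by (simp add: eventually_at_filter)
    have "filterlim ?g (at 0) (at 0)"
      by (intro filterlim_atI lim) (use nz nz' in eventually_elim, simp)
    then have "(\<lambda>w. - a (1 / ?g w) / (?g w)\<^sup>2) \<midarrow>0\<rightarrow> l"
      using l by (rule filterlim_compose[rotated])
    then have "(\<lambda>w. - a (1 / ?g w) / (?g w)\<^sup>2 / (c + d * w)\<^sup>2) \<midarrow>0\<rightarrow> l / (c + d * 0)\<^sup>2"
      by (intro tendsto_intros) (use c in auto)
    moreover have "\<forall>\<^sub>F w in at 0. - a (1 / ?g w) / (?g w)\<^sup>2 / (c + d * w)\<^sup>2 = - a (c * (1 / w) + d) / w\<^sup>2"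
      using nz nz'
    proof eventually_elim
      case (elim w)
      then have "1 / ?g w = c * (1 / w) + d" by (simp add: field_simps)
      then show ?case using elim by (simp add: power_divide)
    qed
    ultimately show ?thesis
      by (intro exI) (rule Lim_transform_eventually)
  qed
  ultimately show ?thesis by (simp add: is_K_coeff_def)
qed


text \<open>The type \<open>form\<close> is the space \<open>\<^bold>K\<close>; \<open>coeff\<close> is the coefficient function \<open>a\<close> of \<open>a(u) du\<close>.\<close>

typedef form = "{a. is_K_coeff a}" morphisms coeff form_of
  using is_K_coeff_zero by blast

setup_lifting type_definition_form

lemma coeff_nicely: "coeff a nicely_meromorphic_on UNIV"
  using coeff[of a] by (simp add: is_K_coeff_def)

instantiation form :: ab_group_add
begin

lift_definition zero_form :: form is "\<lambda>_. 0"
  by (rule is_K_coeff_zero)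

lift_definition plus_form :: "form \<Rightarrow> form \<Rightarrow> form"
  is "\<lambda>a b. remove_sings (\<lambda>z. a z + b z)"
  by (rule is_K_coeff_add)

lift_definition uminus_form :: "form \<Rightarrow> form" is "\<lambda>a z. - a z"
  using is_K_coeff_scale[of _ "-1"] by simp

definition minus_form :: "form \<Rightarrow> form \<Rightarrow> form" where
  "minus_form a b = a + - b"

lemma coeff_add_eventually:
  "\<forall>\<^sub>F w in at z. coeff (a + b) w = coeff a w + coeff b w"
  unfolding plus_form.rep_eq
  by (intro nicely_add_eventually coeff_nicely)

lemma form_eqI:
  assumes "\<And>z. \<forall>\<^sub>F w in at z. coeff a w = coeff b w"
  shows "a = b"
proof -
  have "coeff a z = coeff b z" for z
    using remove_sings_cong[OF assms[of z] refl] by (simp add: nicely_remove_sings coeff_nicely)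
  then show ?thesis by (simp add: coeff_inject[symmetric] fun_eq_iff)
qed

instance
proof
  fix a b c :: form
  show "a + b + c = a + (b + c)"
  proof (rule form_eqI)
    fix z
    show "\<forall>\<^sub>F w in at z. coeff (a + b + c) w = coeff (a + (b + c)) w"
      using coeff_add_eventually[of "a + b" c z] coeff_add_eventually[of a b z]
        coeff_add_eventually[of a "b + c" z] coeff_add_eventually[of b c z]
      by eventually_elim simp
  qed
  show "a + b = b + a"
    by transfer (simp add: add.commute)
  show "0 + a = a"
  proof (rule form_eqI)
    fix z
    show "\<forall>\<^sub>F w in at z. coeff (0 + a) w = coeff a w"
      using coeff_add_eventually[of 0 a z]
      by eventually_elim (simp add: zero_form.rep_eq)
  qed
  show "- a + a = 0"
  proof (rule form_eqI)
    fix z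
    show "\<forall>\<^sub>F w in at z. coeff (- a + a) w = coeff 0 w"
      using coeff_add_eventually[of "- a" a z]
      by eventually_elim (simp add: zero_form.rep_eq uminus_form.rep_eq)
  qed
  show "a - b = a + - b"
    by (rule minus_form_def)
qed

end

lift_definition scale_form :: "complex \<Rightarrow> form \<Rightarrow> form" is "\<lambda>c a z. c * a z"
  by (rule is_K_coeff_scale)

lemma vector_space_form: "vector_space scale_form"
proof
  fix x y :: complex and a b :: form
  show "scale_form x (a + b) = scale_form x a + scale_form x b"
  proof (rule form_eqI)
    fix z
    show "\<forall>\<^sub>F w in at z. coeff (scale_form x (a + b)) w = coeff (scale_form x a + scale_form x b) w"
      using coeff_add_eventually[of a b z] coeff_add_eventually[of "scale_form x a" "scale_form x b" z]
      by eventually_elim (simp add: scale_form.rep_eq algebra_simps)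
  qed
  show "scale_form (x + y) a = scale_form x a + scale_form y a"
  proof (rule form_eqI)
    fix z
    show "\<forall>\<^sub>F w in at z. coeff (scale_form (x + y) a) w = coeff (scale_form x a + scale_form y a) w"
      using coeff_add_eventually[of "scale_form x a" "scale_form y a" z]
      by eventually_elim (simp add: scale_form.rep_eq algebra_simps)
  qed
  show "scale_form x (scale_form y a) = scale_form (x * y) a"
    by transfer (simp add: mult.assoc)
  show "scale_form 1 a = a"
    by transfer simp
qed

definition poles :: "form \<Rightarrow> complex set" where
  "poles a = {z. is_pole (coeff a) z}"

lift_definition translate_form :: "complex \<Rightarrow> form \<Rightarrow> form"
  is "\<lambda>t a z. a (z - t)"
  using is_K_coeff_affine[of _ 1] by (metis (no_types, lifting) diff_conv_add_uminus ext mult_1 one_neq_zero)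

text \<open>
  Pull-back by the inverse of the rotation \<open>u \<mapsto> p + k (u - p)\<close> about the point with coordinate \<open>p\<close>;
  the factor in front comes from \<open>du\<close>. Only \<open>k \<noteq> 0\<close> is meaningful.
\<close>

lift_definition rotate_form :: "complex \<Rightarrow> complex \<Rightarrow> form \<Rightarrow> form"
  is "\<lambda>p k a z. inverse k * a (p + inverse k * (z - p))"
proof -
  fix p k :: complex and a
  assume a: "is_K_coeff a"
  show "is_K_coeff (\<lambda>z. inverse k * a (p + inverse k * (z - p)))"
  proof (cases "k = 0")
    case True
    then show ?thesis by (simp add: is_K_coeff_zero)
  next
    case False
    have "p + inverse k * (z - p) = inverse k * z + (p - inverse k * p)" for z
      by (simp add: algebra_simps)
    moreover have "is_K_coeff (\<lambda>z. inverse k * a (inverse k * z + (p - inverse k * p)))"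
      using False by (intro is_K_coeff_scale is_K_coeff_affine a) simp
    ultimately show ?thesis by (simp only:)
  qed
qed

definition linear_form_map :: "(form \<Rightarrow> form) \<Rightarrow> bool" where
  "linear_form_map \<phi> \<longleftrightarrow>
     (\<forall>a b. \<phi> (a + b) = \<phi> a + \<phi> b) \<and> (\<forall>c a. \<phi> (scale_form c a) = scale_form c (\<phi> a))"

lemma eventually_affine:
  fixes c d z :: complex
  assumes "c \<noteq> 0" "\<forall>\<^sub>F w in at (c * z + d). Q w"
  shows "\<forall>\<^sub>F w in at z. Q (c * w + d)"
  using assms(2) unfolding filtermap_affine_at[OF assms(1), symmetric] eventually_filtermap .

lemma linear_translate_form: "linear_form_map (translate_form t)"
  unfolding linear_form_map_def
proof (intro conjI allI)
  fix a b c
  show "translate_form t (a + b) = translate_form t a + translate_form t b"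
  proof (rule form_eqI)
    fix z
    have "\<forall>\<^sub>F w in at z. coeff (a + b) (1 * w + - t) = coeff a (1 * w + - t) + coeff b (1 * w + - t)"
      by (intro eventually_affine coeff_add_eventually) simp
    then show "\<forall>\<^sub>F w in at z. coeff (translate_form t (a + b)) w =
        coeff (translate_form t a + translate_form t b) w"
      using coeff_add_eventually[of "translate_form t a" "translate_form t b" z]
      by eventually_elim (simp add: translate_form.rep_eq)
  qed
  show "translate_form t (scale_form c a) = scale_form c (translate_form t a)"
    by transfer simp
qed

lemma linear_rotate_form: "linear_form_map (rotate_form p k)"
  unfolding linear_form_map_def
proof (intro conjI allI)
  fix a b c
  show "rotate_form p k (a + b) = rotate_form p k a + rotate_form p k b"
  proof (rule form_eqI)
    fix z
    let ?g = "\<lambda>z. p + inverse k * (z - p)"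
    have "\<forall>\<^sub>F w in at z. inverse k * coeff (a + b) (?g w) = inverse k * (coeff a (?g w) + coeff b (?g w))"
    proof (cases "k = 0")
      case False
      have g: "?g w = inverse k * w + (p - inverse k * p)" for w
        by (simp add: algebra_simps)
      have "\<forall>\<^sub>F w in at z. coeff (a + b) (inverse k * w + (p - inverse k * p)) =
          coeff a (inverse k * w + (p - inverse k * p)) + coeff b (inverse k * w + (p - inverse k * p))"
        using False by (intro eventually_affine coeff_add_eventually) simp
      then show ?thesis unfolding g by eventually_elim simp
    qed simp
    then show "\<forall>\<^sub>F w in at z. coeff (rotate_form p k (a + b)) w =
        coeff (rotate_form p k a + rotate_form p k b) w"
      using coeff_add_eventually[of "rotate_form p k a" "rotate_form p k b" z]
      by eventually_elim (simp add: rotate_form.rep_eq algebra_simps)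
  qed
  show "rotate_form p k (scale_form c a) = scale_form c (rotate_form p k a)"
    by transfer (simp add: mult.left_commute)
qed

text \<open>
  \<open>\<^bold>W = S\<^sup>*\<^bold>K\<close> is the free commutative algebra on the set \<open>\<^bold>K\<close> (polynomials, with finite multisets of
  forms as monomials) modulo the ideal of the linear relations of \<open>\<^bold>K\<close>. The vacuum is \<open>1\<close>.
\<close>

abbreviation gen :: "form \<Rightarrow> form multiset \<Rightarrow>\<^sub>0 complex" where
  "gen a \<equiv> Poly_Mapping.single {#a#} 1"

inductive_set lin_ideal :: "(form multiset \<Rightarrow>\<^sub>0 complex) set" where
  rel_add: "gen (a + b) - (gen a + gen b) \<in> lin_ideal"
| rel_scale: "gen (scale_form c a) - Poly_Mapping.single 0 c * gen a \<in> lin_ideal"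
| sum: "p \<in> lin_ideal \<Longrightarrow> q \<in> lin_ideal \<Longrightarrow> p + q \<in> lin_ideal"
| mult: "p \<in> lin_ideal \<Longrightarrow> q * p \<in> lin_ideal"

definition lin_rel :: "(form multiset \<Rightarrow>\<^sub>0 complex) \<Rightarrow> (form multiset \<Rightarrow>\<^sub>0 complex) \<Rightarrow> bool" where
  "lin_rel p q \<longleftrightarrow> p - q \<in> lin_ideal"

lemma lin_ideal_0: "0 \<in> lin_ideal"
  using lin_ideal.mult[OF lin_ideal.rel_add, of 0] by simp

lemma lin_ideal_uminus: "p \<in> lin_ideal \<Longrightarrow> - p \<in> lin_ideal"
  using lin_ideal.mult[of p "-1"] by simp

lemma lin_ideal_diff: "p \<in> lin_ideal \<Longrightarrow> q \<in> lin_ideal \<Longrightarrow> p - q \<in> lin_ideal"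
  using lin_ideal.sum[OF _ lin_ideal_uminus] by force

quotient_type W = "form multiset \<Rightarrow>\<^sub>0 complex" / lin_rel
proof (rule equivpI)
  show "reflp lin_rel"
    by (simp add: reflp_def lin_rel_def lin_ideal_0)
  show "symp lin_rel"
    unfolding symp_def lin_rel_def by (metis lin_ideal_uminus minus_diff_eq)
  show "transp lin_rel"
    unfolding transp_def lin_rel_def
  proof (intro allI impI)
    fix p q r :: "form multiset \<Rightarrow>\<^sub>0 complex"
    assume "p - q \<in> lin_ideal" "q - r \<in> lin_ideal"
    from lin_ideal.sum[OF this] show "p - r \<in> lin_ideal" by simp
  qed
qed

lemma lookup_mult_zero:
  fixes p q :: "form multiset \<Rightarrow>\<^sub>0 complex"
  shows "Poly_Mapping.lookup (p * q) 0 = Poly_Mapping.lookup p 0 * Poly_Mapping.lookup q 0"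
proof -
  have "(\<Sum>r. Poly_Mapping.lookup q r when 0 = l + r) = (Poly_Mapping.lookup q 0 when l = 0)"
    for l :: "form multiset"
  proof -
    have "(\<lambda>r. Poly_Mapping.lookup q r when 0 = l + r) =
        (\<lambda>r. (Poly_Mapping.lookup q 0 when l = 0) when r = 0)"
      by (auto simp: when_def fun_eq_iff)
    then show ?thesis by (simp only: Sum_any_when_equal)
  qed
  then have "Poly_Mapping.lookup (p * q) 0 =
      (\<Sum>l. Poly_Mapping.lookup p l * Poly_Mapping.lookup q 0 when l = 0)"
    by (simp add: lookup_mult mult_when)
  then show ?thesis by simp
qed

lemma lookup_lin_ideal: "p \<in> lin_ideal \<Longrightarrow> Poly_Mapping.lookup p 0 = 0"
  by (induction rule: lin_ideal.induct)
     (auto simp: lookup_minus lookup_add lookup_mult_zero lookup_single)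

instantiation W :: comm_ring_1
begin

lift_definition zero_W :: W is 0 .
lift_definition one_W :: W is 1 .
lift_definition plus_W :: "W \<Rightarrow> W \<Rightarrow> W" is "(+)"
  unfolding lin_rel_def using lin_ideal.sum by (metis add_diff_add)
lift_definition uminus_W :: "W \<Rightarrow> W" is uminus
  unfolding lin_rel_def using lin_ideal_uminus by (metis minus_diff_minus)
lift_definition minus_W :: "W \<Rightarrow> W \<Rightarrow> W" is "(-)"
proof -
  fix p p' q q'
  assume "lin_rel p p'" "lin_rel q q'"
  then have "(p - p') - (q - q') \<in> lin_ideal"
    unfolding lin_rel_def by (rule lin_ideal_diff)
  then show "lin_rel (p - q) (p' - q')"
    by (simp add: lin_rel_def algebra_simps)
qed
lift_definition times_W :: "W \<Rightarrow> W \<Rightarrow> W" is "(*)"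
proof -
  fix p p' q q'
  assume "lin_rel p p'" "lin_rel q q'"
  then have "q * (p - p') + p' * (q - q') \<in> lin_ideal"
    unfolding lin_rel_def by (intro lin_ideal.intros)
  then show "lin_rel (p * q) (p' * q')"
    by (simp add: lin_rel_def algebra_simps)
qed

instance
proof
  show "(0::W) \<noteq> 1"
  proof transfer
    show "\<not> lin_rel 0 1"
      using lookup_lin_ideal[of "- 1"] by (auto simp: lin_rel_def)
  qed
qed (transfer; simp add: lin_rel_def lin_ideal_0 algebra_simps)+

end

lift_definition const_W :: "complex \<Rightarrow> W" is "\<lambda>c. Poly_Mapping.single 0 c" .

lift_definition incl_W :: "form \<Rightarrow> W" is gen .

definition scale_W :: "complex \<Rightarrow> W \<Rightarrow> W" where
  "scale_W c x = const_W c * x"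

lemma const_W_add: "const_W (c + d) = const_W c + const_W d"
  by transfer (simp add: lin_rel_def lin_ideal_0 single_add)

lemma const_W_mult: "const_W (c * d) = const_W c * const_W d"
  by transfer (simp add: lin_rel_def lin_ideal_0 mult_single)

lemma const_W_1: "const_W 1 = 1"
  by transfer (simp add: lin_rel_def lin_ideal_0)

interpretation W: vector_space scale_W
  by standard (simp_all add: scale_W_def const_W_add const_W_mult const_W_1 algebra_simps)

lemma incl_W_add: "incl_W (a + b) = incl_W a + incl_W b"
  by transfer (simp add: lin_rel_def lin_ideal.rel_add)

lemma incl_W_scale: "incl_W (scale_form c a) = scale_W c (incl_W a)"
  unfolding scale_W_def by transfer (simp add: lin_rel_def lin_ideal.rel_scale)

definition free_map :: "(form \<Rightarrow> form) \<Rightarrow> (form multiset \<Rightarrow>\<^sub>0 complex) \<Rightarrow> (form multiset \<Rightarrow>\<^sub>0 complex)" where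
  "free_map \<phi> p =
     (\<Sum>m\<in>Poly_Mapping.keys p. Poly_Mapping.single (image_mset \<phi> m) (Poly_Mapping.lookup p m))"

lemma free_map_superset:
  assumes "finite A" "Poly_Mapping.keys p \<subseteq> A"
  shows "free_map \<phi> p = (\<Sum>m\<in>A. Poly_Mapping.single (image_mset \<phi> m) (Poly_Mapping.lookup p m))"
  unfolding free_map_def
  by (rule sum.mono_neutral_left) (use assms in \<open>auto simp: in_keys_iff\<close>)

lemma free_map_add: "free_map \<phi> (p + q) = free_map \<phi> p + free_map \<phi> q"
proof -
  let ?A = "Poly_Mapping.keys p \<union> Poly_Mapping.keys q"
  have "free_map \<phi> r = (\<Sum>m\<in>?A. Poly_Mapping.single (image_mset \<phi> m) (Poly_Mapping.lookup r m))"
    if "r \<in> {p, q, p + q}" for r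
    using that keys_add[of p q] by (intro free_map_superset) auto
  then show ?thesis
    by (simp add: lookup_add single_add sum.distrib)
qed

lemma free_map_single [simp]:
  "free_map \<phi> (Poly_Mapping.single m c) = Poly_Mapping.single (image_mset \<phi> m) c"
  using free_map_superset[of "{m}" "Poly_Mapping.single m c" \<phi>] by simp

lemma free_map_0 [simp]: "free_map \<phi> 0 = 0"
  by (simp add: free_map_def)

lemma free_map_uminus: "free_map \<phi> (- p) = - free_map \<phi> p"
  using free_map_add[of \<phi> p "- p"] by (simp add: eq_neg_iff_add_eq_0 add.commute)

lemma free_map_diff: "free_map \<phi> (p - q) = free_map \<phi> p - free_map \<phi> q"
  using free_map_add[of \<phi> p "- q"] by (simp add: free_map_uminus)

lemma free_map_sum: "free_map \<phi> (sum f A) = (\<Sum>i\<in>A. free_map \<phi> (f i))"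
  by (induction A rule: infinite_finite_induct) (auto simp: free_map_add)

lemma free_alg_expand:
  "p = (\<Sum>m\<in>Poly_Mapping.keys p. Poly_Mapping.single m (Poly_Mapping.lookup p m))"
  by (rule poly_mapping_eqI)
     (auto simp: lookup_sum lookup_single when_def in_keys_iff)

lemma free_map_mult: "free_map \<phi> (p * q) = free_map \<phi> p * free_map \<phi> q"
proof -
  let ?s = "\<lambda>p m. Poly_Mapping.single m (Poly_Mapping.lookup p m)"
  have "free_map \<phi> (p * q) =
      free_map \<phi> (\<Sum>m\<in>Poly_Mapping.keys p. \<Sum>n\<in>Poly_Mapping.keys q. ?s p m * ?s q n)"
    by (subst free_alg_expand[of p], subst free_alg_expand[of q]) (simp only: sum_product)
  also have "\<dots> = (\<Sum>m\<in>Poly_Mapping.keys p. \<Sum>n\<in>Poly_Mapping.keys q.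
      free_map \<phi> (?s p m) * free_map \<phi> (?s q n))"
    by (simp add: free_map_sum mult_single)
  also have "\<dots> = free_map \<phi> p * free_map \<phi> q"
    by (simp add: free_map_def[of \<phi> p] free_map_def[of \<phi> q] sum_product)
  finally show ?thesis .
qed

lemma free_map_lin_ideal:
  assumes "linear_form_map \<phi>" "p \<in> lin_ideal"
  shows "free_map \<phi> p \<in> lin_ideal"
  using assms(2)
proof induction
  case (rel_add a b)
  then show ?case
    using assms(1) by (simp add: free_map_diff free_map_add linear_form_map_def lin_ideal.rel_add)
next
  case (rel_scale c a)
  then show ?case
    using assms(1) lin_ideal.rel_scale[of c "\<phi> a"]
    by (simp add: free_map_diff free_map_mult linear_form_map_def)
qed (auto simp: free_map_add free_map_mult intro: lin_ideal.intros)

lift_definition translate_W :: "complex \<Rightarrow> W \<Rightarrow> W" is "\<lambda>t. free_map (translate_form t)"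
  unfolding lin_rel_def
  by (metis free_map_diff free_map_lin_ideal linear_translate_form)

lift_definition rotate_W :: "complex \<Rightarrow> complex \<Rightarrow> W \<Rightarrow> W" is "\<lambda>p k. free_map (rotate_form p k)"
  unfolding lin_rel_def
  by (metis free_map_diff free_map_lin_ideal linear_rotate_form)

text \<open>\<open>S\<^sup>*L\<close> for a subspace \<open>L\<close> of \<open>\<^bold>K\<close>, as the subalgebra of \<open>\<^bold>W\<close> generated by \<open>L\<close>.\<close>

inductive_set sym_sub :: "form set \<Rightarrow> W set" for L where
  const: "const_W c \<in> sym_sub L"
| incl: "a \<in> L \<Longrightarrow> incl_W a \<in> sym_sub L"
| add: "x \<in> sym_sub L \<Longrightarrow> y \<in> sym_sub L \<Longrightarrow> x + y \<in> sym_sub L"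
| mult: "x \<in> sym_sub L \<Longrightarrow> y \<in> sym_sub L \<Longrightarrow> x * y \<in> sym_sub L"

text \<open>
  The points of the projective line form a type \<open>'p\<close>, and its structure as a projective line with
  marked point \<open>P\<close> is given by a coordinate \<open>u\<close> with pole at \<open>P\<close>, of which only the values off \<open>P\<close>
  matter. A translation \<open>v\<close> is represented by the complex number \<open>t = u(v)\<close>.
\<close>

definition coordinate :: "'p \<Rightarrow> ('p \<Rightarrow> complex) \<Rightarrow> bool" where
  "coordinate P u \<longleftrightarrow> bij_betw u (- {P}) UNIV"

definition point_at :: "'p \<Rightarrow> ('p \<Rightarrow> complex) \<Rightarrow> complex \<Rightarrow> 'p" where
  "point_at P u = inv_into (- {P}) u"

definition translate :: "'p \<Rightarrow> ('p \<Rightarrow> complex) \<Rightarrow> complex \<Rightarrow> 'p \<Rightarrow> 'p" where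
  "translate P u t z = (if z = P then P else point_at P u (u z + t))"

definition rotate :: "'p \<Rightarrow> ('p \<Rightarrow> complex) \<Rightarrow> 'p \<Rightarrow> complex \<Rightarrow> 'p \<Rightarrow> 'p" where
  "rotate P u b k z = (if z = P then P else point_at P u (u b + k * (u z - u b)))"

definition finite_affine :: "'p \<Rightarrow> 'p set \<Rightarrow> bool" where
  "finite_affine P S \<longleftrightarrow> finite S \<and> P \<notin> S"

text \<open>\<open>W_at u S\<close> is \<open>\<^sub>S\<^bold>W\<close> and \<open>W_off u S\<close> is \<open>\<^bold>W\<^sup>S\<close>.\<close>

definition W_at :: "('p \<Rightarrow> complex) \<Rightarrow> 'p set \<Rightarrow> W set" where
  "W_at u S = sym_sub {a. poles a \<subseteq> u ` S}"

definition W_off :: "('p \<Rightarrow> complex) \<Rightarrow> 'p set \<Rightarrow> W set" where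
  "W_off u S = sym_sub {a. poles a \<inter> u ` S = {}}"

text \<open>
  \<open>Y S v t\<close> is the operator \<open>Y(v, t)\<close> on the domain \<open>W_off u (S + t)\<close>, for a state \<open>v\<close> regarded as an
  element of \<open>W_at u S\<close>; its values outside this domain are arbitrary and never used.
  Locality is required exactly at those vectors where both compositions are defined. In
  \<open>spanning\<close> the list is \<open>[(v\<^sub>n, t\<^sub>n), \<dots>, (v\<^sub>1, t\<^sub>1)]\<close>.
\<close>

locale chiral_boson_vertex_algebra =
  fixes P :: 'p
    and u :: "'p \<Rightarrow> complex"
    and Y :: "'p set \<Rightarrow> W \<Rightarrow> complex \<Rightarrow> W \<Rightarrow> W"
  assumes coordinate: "coordinate P u"
    and state_add:
      "\<lbrakk>finite_affine P S; v \<in> W_at u S; v' \<in> W_at u S; x \<in> W_off u (translate P u t ` S)\<rbrakk>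
       \<Longrightarrow> Y S (v + v') t x = Y S v t x + Y S v' t x"
    and state_scale:
      "\<lbrakk>finite_affine P S; v \<in> W_at u S; x \<in> W_off u (translate P u t ` S)\<rbrakk>
       \<Longrightarrow> Y S (scale_W c v) t x = scale_W c (Y S v t x)"
    and operator_add:
      "\<lbrakk>finite_affine P S; v \<in> W_at u S;
        x \<in> W_off u (translate P u t ` S); y \<in> W_off u (translate P u t ` S)\<rbrakk>
       \<Longrightarrow> Y S v t (x + y) = Y S v t x + Y S v t y"
    and operator_scale:
      "\<lbrakk>finite_affine P S; v \<in> W_at u S; x \<in> W_off u (translate P u t ` S)\<rbrakk>
       \<Longrightarrow> Y S v t (scale_W c x) = scale_W c (Y S v t x)"
    and enlarge:
      "\<lbrakk>finite_affine P S'; S \<subseteq> S'; v \<in> W_at u S; x \<in> W_off u (translate P u t ` S')\<rbrakk>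
       \<Longrightarrow> Y S' v t x = Y S v t x"
    and support:
      "\<lbrakk>finite_affine P S; finite_affine P S'; v \<in> W_at u S;
        v' \<in> W_at u S'; v' \<in> W_off u (translate P u t ` S)\<rbrakk>
       \<Longrightarrow> Y S v t v' \<in> W_at u (S' \<union> translate P u t ` S)"
    and vacuum:
      "\<lbrakk>finite_affine P S; x \<in> W_off u (translate P u t ` S)\<rbrakk> \<Longrightarrow> Y S 1 t x = x"
    and creation:
      "\<lbrakk>finite_affine P S; v \<in> W_at u S\<rbrakk> \<Longrightarrow> Y S v 0 1 = v"
    and locality:
      "\<lbrakk>finite_affine P S; finite_affine P S'; v \<in> W_at u S; v' \<in> W_at u S';
        translate P u t ` S \<inter> translate P u t' ` S' = {};
        x \<in> W_off u (translate P u t ` S); x \<in> W_off u (translate P u t' ` S');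
        Y S v t x \<in> W_off u (translate P u t' ` S');
        Y S' v' t' x \<in> W_off u (translate P u t ` S)\<rbrakk>
       \<Longrightarrow> Y S v t (Y S' v' t' x) = Y S' v' t' (Y S v t x)"
    and translation:
      "\<lbrakk>finite_affine P S; v \<in> W_at u S; x \<in> W_off u (translate P u (t + t') ` S)\<rbrakk>
       \<Longrightarrow> Y S v (t + t') x = translate_W t' (Y S v t (translate_W (- t') x))"
    and translation_covariance:
      "\<lbrakk>finite_affine P S; v \<in> W_at u S;
        x \<in> W_off u (translate P u t ` translate P u t' ` S)\<rbrakk>
       \<Longrightarrow> Y (translate P u t' ` S) (translate_W t' v) t x =
           translate_W t' (Y S v t (translate_W (- t') x))"
    and rotation_covariance:
      "\<lbrakk>finite_affine P S; v \<in> W_at u S; b \<noteq> P; k \<noteq> 0;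
        x \<in> W_off u (translate P u (k * t) ` rotate P u b k ` S)\<rbrakk>
       \<Longrightarrow> Y (rotate P u b k ` S) (rotate_W (u b) k v) (k * t) x =
           rotate_W (u b) k (Y S v t (rotate_W (u b) (inverse k) x))"
    and spanning:
      "\<exists>b. b \<noteq> P \<and>
         W.span {foldr (\<lambda>(v, t) x. Y {b} v t x) vts 1 | vts.
           distinct (map snd vts) \<and> fst ` set vts \<subseteq> W_at u {b}} = UNIV"

end

theory Submission
  imports Defs
begin

text \<open>
  Every vector \<open>x\<close> is created from the vacuum by its own field: it is a polynomial in finitely many
  forms with finitely many poles each, so it is supported on a finite set \<open>S'\<close>, and
  \<open>x = Y(x, 0) 1\<close> by the creation axiom. If \<open>x\<close> is regular on \<open>(S\<^sub>1 + t\<^sub>1) \<union> (S\<^sub>2 + t\<^sub>2)\<close>, then \<open>S'\<close> can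
  be chosen disjoint from that set (\<open>W_off_imp_W_at\<close>), and by locality \<open>Y(x, 0)\<close> commutes with all
  the operators in the identity:
  \<open>Y(v\<^sub>1, t\<^sub>1) Y(v\<^sub>2, t\<^sub>2) x = Y(x, 0) Y(v\<^sub>1, t\<^sub>1) Y(v\<^sub>2, t\<^sub>2) 1\<close> and
  \<open>Y(Y(v\<^sub>1, t\<^sub>1 - t\<^sub>2) v\<^sub>2, t\<^sub>2) x = Y(x, 0) Y(Y(v\<^sub>1, t\<^sub>1 - t\<^sub>2) v\<^sub>2, t\<^sub>2) 1\<close>.

  It remains to compare the two sides on the vacuum. With \<open>T\<close> for the translation operators, the
  translation and creation axioms give \<open>Y(v, t) 1 = T\<^sub>t v\<close>, and then
  \<open>Y(v\<^sub>1, t\<^sub>1) Y(v\<^sub>2, t\<^sub>2) 1 = Y(v\<^sub>1, t\<^sub>1) T\<^sub>t\<^sub>2 v\<^sub>2 = T\<^sub>t\<^sub>2 Y(v\<^sub>1, t\<^sub>1 - t\<^sub>2) v\<^sub>2 = Y(Y(v\<^sub>1, t\<^sub>1 - t\<^sub>2) v\<^sub>2, t\<^sub>2) 1\<close>.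
  This is Goddard's uniqueness argument for fields with the same action on the vacuum.
\<close>

section \<open>Supports of vectors\<close>

text \<open>Regularity at infinity confines the poles to a disc, where they are isolated.\<close>

lemma finite_poles: "finite (poles a)"
proof -
  have "\<forall>\<^sub>F z in at_infinity. coeff a analytic_on {z}"
    using coeff[of a] by (intro is_K_coeff_analytic_infinity) simp
  then obtain B where B: "\<And>z. norm z \<ge> B \<Longrightarrow> coeff a analytic_on {z}"
    unfolding eventually_at_infinity by blast
  have "poles a \<subseteq> cball 0 B"
  proof
    fix z assume "z \<in> poles a"
    then have "\<not> coeff a analytic_on {z}"
      by (auto simp: poles_def analytic_at_imp_no_pole)
    with B show "z \<in> cball 0 B" by force
  qed
  moreover have "poles a sparse_in UNIV"
    using meromorphic_on_imp_not_pole_cosparse[of "coeff a" UNIV] coeff_nicely[of a]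
    by (simp add: eventually_cosparse nicely_meromorphic_on_def poles_def)
  then have "finite (cball 0 B \<inter> poles a)"
    by (intro sparse_in_compact_finite) (auto intro: sparse_in_subset)
  ultimately show ?thesis
    by (simp add: Int_absorb1)
qed

lemma sym_sub_mono: "L \<subseteq> M \<Longrightarrow> x \<in> sym_sub L \<Longrightarrow> x \<in> sym_sub M"
  by (erule sym_sub.induct) (auto intro: sym_sub.intros)

lemma sym_sub_finite_support:
  assumes "x \<in> sym_sub {a. poles a \<inter> D = {}}"
  shows "\<exists>Q. finite Q \<and> Q \<inter> D = {} \<and> x \<in> sym_sub {a. poles a \<subseteq> Q}"
    (is "\<exists>Q. _ \<and> _ \<and> x \<in> ?U Q")
  using assms
proof induction
  case (const c)
  show ?case by (intro exI[of _ "{}"]) (auto intro: sym_sub.const)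
next
  case (incl a)
  then show ?case by (intro exI[of _ "poles a"]) (auto simp: finite_poles intro: sym_sub.incl)
next
  case (add x y)
  then obtain Q R where "finite Q" "Q \<inter> D = {}" "x \<in> sym_sub {a. poles a \<subseteq> Q}"
    "finite R" "R \<inter> D = {}" "y \<in> sym_sub {a. poles a \<subseteq> R}" by blast
  moreover from this have "x \<in> ?U (Q \<union> R)" "y \<in> ?U (Q \<union> R)"
    by (auto elim!: sym_sub_mono[rotated])
  ultimately show ?case
    by (intro exI[of _ "Q \<union> R"]) (simp add: Int_Un_distrib2 sym_sub.add)
next
  case (mult x y)
  then obtain Q R where "finite Q" "Q \<inter> D = {}" "x \<in> sym_sub {a. poles a \<subseteq> Q}"
    "finite R" "R \<inter> D = {}" "y \<in> sym_sub {a. poles a \<subseteq> R}" by blast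
  moreover from this have "x \<in> ?U (Q \<union> R)" "y \<in> ?U (Q \<union> R)"
    by (auto elim!: sym_sub_mono[rotated])
  ultimately show ?case
    by (intro exI[of _ "Q \<union> R"]) (simp add: Int_Un_distrib2 sym_sub.mult)
qed

lemma one_mem_sym_sub: "1 \<in> sym_sub L"
  using sym_sub.const[of 1 L] by (simp add: const_W_1)

section \<open>The translation operators\<close>

lemma translate_W_one: "translate_W t 1 = 1"
proof transfer
  fix t
  have "free_map (translate_form t) 1 = 1"
    by (simp flip: single_one)
  then show "lin_rel (free_map (translate_form t) 1) 1"
    by (simp add: lin_rel_def lin_ideal_0)
qed

lemma translate_W_minus_cancel: "translate_W (- t) (translate_W t x) = x"
proof transfer
  fix t and p :: "form multiset \<Rightarrow>\<^sub>0 complex"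
  have "translate_form (- t) (translate_form t a) = a" for a
    by transfer simp
  then have "free_map (translate_form (- t)) (free_map (translate_form t) p) = p"
    by (simp add: free_map_def[of "translate_form t"] free_map_sum multiset.map_comp o_def
        flip: free_alg_expand)
  then show "lin_rel (free_map (translate_form (- t)) (free_map (translate_form t) p)) p"
    by (simp add: lin_rel_def lin_ideal_0)
qed

section \<open>Supports and translations on the projective line\<close>

lemma finite_affine_Un:
  "finite_affine P A \<Longrightarrow> finite_affine P B \<Longrightarrow> finite_affine P (A \<union> B)"
  by (auto simp: finite_affine_def)

context
  fixes P :: 'p and u :: "'p \<Rightarrow> complex"
  assumes coord: "coordinate P u"
begin

lemma inj_on_coordinate: "inj_on u (- {P})"
  using coord by (simp add: coordinate_def bij_betw_def)

lemma point_at_coordinate: "u (point_at P u c) = c" "point_at P u c \<noteq> P"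
proof -
  have "c \<in> u ` (- {P})"
    using coord by (simp add: coordinate_def bij_betw_def)
  from f_inv_into_f[OF this] inv_into_into[OF this]
  show "u (point_at P u c) = c" "point_at P u c \<noteq> P"
    by (simp_all add: point_at_def)
qed

lemma coordinate_point_at: "z \<noteq> P \<Longrightarrow> point_at P u (u z) = z"
  unfolding point_at_def using inv_into_f_f[OF inj_on_coordinate] by simp

lemma translate_translate:
  "translate P u s (translate P u t z) = translate P u (t + s) z"
  by (simp add: translate_def point_at_coordinate add.assoc)

lemma translate_zero: "translate P u 0 z = z"
  by (simp add: translate_def coordinate_point_at)

lemma translate_image_zero: "translate P u 0 ` S = S"
  by (simp add: translate_zero)

lemma finite_affine_translate: "finite_affine P S \<Longrightarrow> finite_affine P (translate P u t ` S)"
  by (auto simp: finite_affine_def translate_def point_at_coordinate(2)[symmetric] split: if_splits)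

text \<open>
  Away from \<open>P\<close> the coordinate is injective, so disjoint sets of points give disjoint sets of
  coordinates. Through this, information on supports yields the domain conditions of the axioms.
\<close>

lemma W_at_imp_W_off:
  assumes "x \<in> W_at u S" "finite_affine P S" "finite_affine P D" "S \<inter> D = {}"
  shows "x \<in> W_off u D"
proof -
  have "S \<subseteq> - {P}" "D \<subseteq> - {P}"
    using assms(2,3) by (auto simp: finite_affine_def)
  then have "u ` S \<inter> u ` D = {}"
    using inj_on_image_Int[OF inj_on_coordinate, of S D] assms(4) by simp
  then have "{a. poles a \<subseteq> u ` S} \<subseteq> {a. poles a \<inter> u ` D = {}}"
    by blast
  from sym_sub_mono[OF this] assms(1) show ?thesis
    by (simp add: W_at_def W_off_def)
qed

text \<open>
  The converse, with a suitable support: the poles of the finitely many forms in an expression of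
  \<open>x\<close> as a polynomial.
\<close>

lemma W_off_imp_W_at:
  assumes "x \<in> W_off u D"
  obtains S where "finite_affine P S" "S \<inter> D = {}" "x \<in> W_at u S"
proof -
  obtain Q where Q: "finite Q" "Q \<inter> u ` D = {}" "x \<in> sym_sub {a. poles a \<subseteq> Q}"
    using sym_sub_finite_support[of x "u ` D"] assms unfolding W_off_def by auto
  show ?thesis
  proof (rule that)
    show "finite_affine P (point_at P u ` Q)"
      using Q(1) by (auto simp: finite_affine_def point_at_coordinate(2)[symmetric])
    show "point_at P u ` Q \<inter> D = {}"
    proof -
      have "point_at P u c \<notin> D" if "c \<in> Q" for c
        using Q(2) that point_at_coordinate(1)[of c] imageI[of "point_at P u c" D u] by auto
      then show ?thesis by blast
    qed
    show "x \<in> W_at u (point_at P u ` Q)"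
      using Q(3) by (simp add: W_at_def image_image point_at_coordinate)
  qed
qed

end

section \<open>Goddard's uniqueness argument and associativity\<close>

context chiral_boson_vertex_algebra
begin

lemma vertex_op_vacuum:
  assumes "finite_affine P S" "v \<in> W_at u S"
  shows "Y S v t 1 = translate_W t v"
  using translation[OF assms, of 1 0 t] creation[OF assms]
  by (simp add: translate_W_one W_off_def one_mem_sym_sub)

lemma vertex_op_translate:
  assumes "finite_affine P S" "v \<in> W_at u S" "translate_W t' w \<in> W_off u (translate P u t ` S)"
  shows "Y S v t (translate_W t' w) = translate_W t' (Y S v (t - t') w)"
  using translation[OF assms(1,2), of "translate_W t' w" "t - t'" t'] assms(3)
  by (simp add: translate_W_minus_cancel)

text \<open>
  The form of locality in which all domain conditions follow from the disjointness of supports: the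
  support axiom puts \<open>Y(x, 0) y\<close> on \<open>R \<union> X\<close> and \<open>Y(v, t) y\<close> on \<open>R \<union> (S + t)\<close>.
\<close>

lemma vertex_op_commute_creation:
  assumes S: "finite_affine P S" "v \<in> W_at u S"
    and X: "finite_affine P X" "x \<in> W_at u X"
    and R: "finite_affine P R" "y \<in> W_at u R"
    and disj: "X \<inter> translate P u t ` S = {}" "R \<inter> translate P u t ` S = {}" "X \<inter> R = {}"
  shows "Y S v t (Y X x 0 y) = Y X x 0 (Y S v t y)"
proof -
  note co = coordinate
  note [simp] = translate_image_zero[OF co]
  have fS: "finite_affine P (translate P u t ` S)"
    by (rule finite_affine_translate[OF co S(1)])
  have y: "y \<in> W_off u (translate P u t ` S)" "y \<in> W_off u X"
    using W_at_imp_W_off[OF co R(2,1)] fS X(1) disj by (simp_all add: Int_commute)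
  have "Y S v t y \<in> W_at u (R \<union> translate P u t ` S)"
    using support[OF S(1) R(1) S(2) R(2)] y by simp
  then have 1: "Y S v t y \<in> W_off u X"
    by (rule W_at_imp_W_off[OF co]) (use fS X R disj finite_affine_Un in auto)
  have "Y X x 0 y \<in> W_at u (R \<union> X)"
    using support[OF X(1) R(1) X(2) R(2), of 0] y by simp
  then have 2: "Y X x 0 y \<in> W_off u (translate P u t ` S)"
    by (rule W_at_imp_W_off[OF co]) (use fS X R disj finite_affine_Un in auto)
  show ?thesis
    using locality[OF S(1) X(1) S(2) X(2), of t 0 y] y 1 2 disj by auto
qed

lemma associativity:
  assumes S1: "finite_affine P S1" "v1 \<in> W_at u S1"
    and S2: "finite_affine P S2" "v2 \<in> W_at u S2"
    and disj: "translate P u t1 ` S1 \<inter> translate P u t2 ` S2 = {}"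
  shows "v2 \<in> W_off u (translate P u (t1 - t2) ` S1)"
    and "Y S1 v1 (t1 - t2) v2 \<in> W_at u (S2 \<union> translate P u (t1 - t2) ` S1)"
    and "x \<in> W_off u (translate P u t1 ` S1 \<union> translate P u t2 ` S2) \<Longrightarrow>
      Y S2 v2 t2 x \<in> W_off u (translate P u t1 ` S1)"
    and "x \<in> W_off u (translate P u t1 ` S1 \<union> translate P u t2 ` S2) \<Longrightarrow>
      Y S1 v1 t1 (Y S2 v2 t2 x) =
        Y (S2 \<union> translate P u (t1 - t2) ` S1) (Y S1 v1 (t1 - t2) v2) t2 x"
proof -
  note co = coordinate
  let ?S1 = "translate P u t1 ` S1" and ?S2 = "translate P u t2 ` S2"
  let ?D = "translate P u (t1 - t2) ` S1"
  let ?w = "Y S1 v1 (t1 - t2) v2"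
  have shift: "translate P u t2 ` ?D = ?S1"
    by (simp add: image_image translate_translate[OF co])
  have fin: "finite_affine P ?S1" "finite_affine P ?S2" "finite_affine P ?D"
    using S1 S2 finite_affine_translate[OF co] by auto
  have emp: "finite_affine P {}" "1 \<in> W_at u {}"
    by (auto simp: finite_affine_def W_at_def one_mem_sym_sub)
  have one: "1 \<in> W_off u A" for A
    by (simp add: W_off_def one_mem_sym_sub)
  have "S2 \<inter> ?D = {}"
    using disj unfolding shift[symmetric] by blast
  with S2 fin show v2: "v2 \<in> W_off u ?D"
    by (intro W_at_imp_W_off[OF co])
  show w: "?w \<in> W_at u (S2 \<union> ?D)"
    by (rule support[OF S1(1) S2(1) S1(2) S2(2) v2])
  have T: "Y S2 v2 t2 1 = translate_W t2 v2"
    by (rule vertex_op_vacuum[OF S2])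
  have y: "Y S2 v2 t2 1 \<in> W_at u ?S2"
    using support[OF S2(1) emp(1) S2(2) emp(2) one] by simp
  then have y': "Y S2 v2 t2 1 \<in> W_off u ?S1"
    by (rule W_at_imp_W_off[OF co]) (use fin disj in auto)
  \<comment> \<open>Both sides agree on the vacuum: they equal the translate of \<open>?w\<close> by \<open>t2\<close>.\<close>
  have vac: "Y S1 v1 t1 (Y S2 v2 t2 1) = Y (S2 \<union> ?D) ?w t2 1"
    using vertex_op_translate[OF S1, of t2 v2 t1] y'
    by (simp add: T vertex_op_vacuum[OF finite_affine_Un[OF S2(1) fin(3)] w])
  \<comment> \<open>The field that creates \<open>x\<close> carries this equality from the vacuum to \<open>x\<close>.\<close>
  fix x assume x: "x \<in> W_off u (?S1 \<union> ?S2)"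
  then obtain X where X: "finite_affine P X" "X \<inter> (?S1 \<union> ?S2) = {}" "x \<in> W_at u X"
    using W_off_imp_W_at[OF co] by blast
  have xoff: "x \<in> W_off u ?S2"
    by (rule W_at_imp_W_off[OF co X(3,1) fin(2)]) (use X in auto)
  have "Y S2 v2 t2 x \<in> W_at u (X \<union> ?S2)"
    by (rule support[OF S2(1) X(1) S2(2) X(3) xoff])
  then show "Y S2 v2 t2 x \<in> W_off u ?S1"
    by (rule W_at_imp_W_off[OF co]) (use fin X disj finite_affine_Un in auto)
  have cr: "Y X x 0 1 = x" by (rule creation[OF X(1,3)])
  have "Y S1 v1 t1 (Y S2 v2 t2 x) = Y S1 v1 t1 (Y S2 v2 t2 (Y X x 0 1))"
    by (simp add: cr)
  also have "Y S2 v2 t2 (Y X x 0 1) = Y X x 0 (Y S2 v2 t2 1)"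
    by (rule vertex_op_commute_creation[OF S2 X(1,3) emp]) (use X in auto)
  also have "Y S1 v1 t1 \<dots> = Y X x 0 (Y S1 v1 t1 (Y S2 v2 t2 1))"
    by (rule vertex_op_commute_creation[OF S1 X(1,3) fin(2) y]) (use X disj in auto)
  also have "Y S1 v1 t1 (Y S2 v2 t2 1) = Y (S2 \<union> ?D) ?w t2 1"
    by (rule vac)
  also have "Y X x 0 \<dots> = Y (S2 \<union> ?D) ?w t2 (Y X x 0 1)"
    by (rule vertex_op_commute_creation[symmetric, OF finite_affine_Un[OF S2(1) fin(3)] w X(1,3) emp])
       (use X in \<open>auto simp: image_Un shift\<close>)
  finally show "Y S1 v1 t1 (Y S2 v2 t2 x) = Y (S2 \<union> ?D) ?w t2 x"
    by (simp add: cr)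
qed

end

(* The membership conjuncts say that both sides of the identity are defined. *)
theorem theorem10p5:
  fixes P :: 'p
    and u :: "'p \<Rightarrow> complex"
    and Y :: "'p set \<Rightarrow> W \<Rightarrow> complex \<Rightarrow> W \<Rightarrow> W"
    and S1 S2 :: "'p set"
    and v1 v2 :: W
    and t1 t2 :: complex
  assumes "chiral_boson_vertex_algebra P u Y"
    and "finite_affine P S1" and "finite_affine P S2"
    and "v1 \<in> W_at u S1" and "v2 \<in> W_at u S2"
    and "translate P u t1 ` S1 \<inter> translate P u t2 ` S2 = {}"
  shows "v2 \<in> W_off u (translate P u (t1 - t2) ` S1) \<and>
    Y S1 v1 (t1 - t2) v2 \<in> W_at u (S2 \<union> translate P u (t1 - t2) ` S1) \<and>
    (\<forall>x \<in> W_off u (translate P u t1 ` S1 \<union> translate P u t2 ` S2).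
       Y S2 v2 t2 x \<in> W_off u (translate P u t1 ` S1) \<and>
       Y S1 v1 t1 (Y S2 v2 t2 x) =
         Y (S2 \<union> translate P u (t1 - t2) ` S1) (Y S1 v1 (t1 - t2) v2) t2 x)"
proof -
  interpret chiral_boson_vertex_algebra P u Y
    by fact
  show ?thesis
    using associativity[OF assms(2,4,3,5,6)] by blast
qed

end
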